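(* Let $(\mathcal G,B)$ be a metric $n$-Lie algebra and $\mathcal G=\mathcal S\oplus\mathcal R$ its Levi decomposition. Then $$\mathrm{Soc}(\mathcal G)=\mathcal C_{\mathcal G}(\mathcal R)=\mathcal R^\bot\oplus\mathcal C(\mathcal G).$$
   Context: Fix an integer $n\ge 2$. All $n$-Lie algebras are finite-dimensional over $\mathbb C$. An $n$-Lie algebra is a vector space $\mathcal G$ with an $n$-multilinear bracket satisfying $[x_1,\dots,x_n]=\mathrm{sign}(\sigma)[x_{\sigma(1)},\dots,x_{\sigma(n)}]$ for all $\sigma\in S_n$ and $[[x_1,\dots,x_n],y_2,\dots,y_n]=\sum_{i=1}^n[x_1,\dots,[x_i,y_2,\dots,y_n],\dots,x_n]$. For subspaces $V_1,\dots,V_n$, $[V_1,\dots,V_n]$ is the span of all brackets $[v_1,\dots,v_n]$ with $v_i\in V_i$. A metric $n$-Lie algebra $(\mathcal G,B)$ is an $n$-Lie algebra with a nondegenerate symmetric bilinear form $B$ that is invariant: $B([x_1,\dots,x_{n-1},y_1],y_2)=-B([x_1,\dots,x_{n-1},y_2],y_1)$ for all $x_i,y_j\in\mathcal G$. For a subspace $W$, $W^\bot=\{x\in\mathcal G: B(w,x)=0\ \forall w\in W\}$. An ideal is a subspace $I$ with $[I,\mathcal G,\dots,\mathcal G]\subseteq I$. A minimal ideal is a non-trivial ideal $I$ (that is, $I\ne 0$ and $I\ne\mathcal G$) such that every ideal $J$ of $\mathcal G$ with $J\subsetneq I$ is $0$. $\mathrm{Soc}(\mathcal G)$ is the sum of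 all minimal ideals of $\mathcal G$; with this convention $\mathrm{Soc}(\mathcal G)=0$ if and only if $\mathcal G$ is simple or one-dimensional. Here $\mathcal G$ is simple if $[\mathcal G,\dots,\mathcal G]\ne0$ and its only ideals are $0$ and $\mathcal G$; it is strong semisimple if it is the direct sum of its simple ideals. An ideal $I$ is solvable if $I^{(s)}=0$ for some $s\ge 0$, where $I^{(0)}=I$ and $I^{(s+1)}=[I^{(s)},\dots,I^{(s)}]$; the radical $\mathcal R$ is the maximal solvable ideal. A Levi decomposition is $\mathcal G=\mathcal S\oplus\mathcal R$ (direct sum of subspaces) with $\mathcal R$ the radical and $\mathcal S$ a strong semisimple subalgebra (possibly zero); one always exists. For a subspace $V$, $\mathcal C_{\mathcal G}(V)=\{x\in\mathcal G:[x,V,\mathcal G,\dots,\mathcal G]=0\}$ is the centralizer of $V$, and $\mathcal C(\mathcal G)=\mathcal C_{\mathcal G}(\mathcal G)$ is the center.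
   Formalization: The equality Soc(G) = C_G(R) is proved only for G not simple and not one-dimensional; in those two cases Soc(G) = 0 while C_G(R) = G (e.g. sl_2 with its Killing form), so it fails. The equality C_G(R) = R^⊥ ⊕ C(G) is proved without restriction. *)

theory Defs
  imports Complex_Main "HOL-Combinatorics.Permutations"
begin

definition is_direct_sum :: "'a::ab_group_add set \<Rightarrow> 'a set \<Rightarrow> 'a set \<Rightarrow> bool" where
  "is_direct_sum W U V \<longleftrightarrow> W = {u + v | u v. u \<in> U \<and> v \<in> V} \<and> U \<inter> V = {0}"

text \<open>
  The underlying space of the algebra is the whole type (which may be trivial, so dimension zero is
  included). The bracket takes the list of its arguments; its values on lists of length different
  from \<open>n\<close> are irrelevant.
\<close>

locale n_lie_algebra = vector_space scale
  for scale :: "complex \<Rightarrow> 'a::ab_group_add \<Rightarrow> 'a" +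
  fixes n :: nat
    and br :: "'a list \<Rightarrow> 'a"
  assumes n_ge_2: "n \<ge> 2"
    and finite_dim: "\<exists>A. finite A \<and> span A = UNIV"
    and multilinear: "\<And>xs i. length xs = n \<Longrightarrow> i < n \<Longrightarrow>
          Vector_Spaces.linear scale scale (\<lambda>x. br (xs[i := x]))"
    and skew: "\<And>xs \<sigma>. length xs = n \<Longrightarrow> \<sigma> permutes {..<n} \<Longrightarrow>
          br xs = scale (of_int (sign \<sigma>)) (br (permute_list \<sigma> xs))"
    and fundamental_identity: "\<And>xs ys. length xs = n \<Longrightarrow> length ys = n - 1 \<Longrightarrow>
          br (br xs # ys) = (\<Sum>i<n. br (xs[i := br (xs ! i # ys)]))"
begin

definition bracket :: "'a set list \<Rightarrow> 'a set" where
  "bracket Vs = span {br vs | vs. list_all2 (\<in>) vs Vs}"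

definition subalgebra :: "'a set \<Rightarrow> bool" where
  "subalgebra H \<longleftrightarrow> subspace H \<and> bracket (replicate n H) \<subseteq> H"

text \<open>
  Ideals, simplicity and strong semisimplicity are relative to a subalgebra \<open>H\<close>, regarded as an
  \<open>n\<close>-Lie algebra in its own right; the algebra itself is \<open>H = UNIV\<close>.
\<close>

definition ideal_of :: "'a set \<Rightarrow> 'a set \<Rightarrow> bool" where
  "ideal_of H I \<longleftrightarrow> subspace I \<and> I \<subseteq> H \<and> bracket (I # replicate (n - 1) H) \<subseteq> I"

definition simple :: "'a set \<Rightarrow> bool" where
  "simple H \<longleftrightarrow> bracket (replicate n H) \<noteq> {0} \<and> (\<forall>I. ideal_of H I \<longrightarrow> I = {0} \<or> I = H)"

definition simple_ideals :: "'a set \<Rightarrow> 'a set set" where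
  "simple_ideals H = {I. ideal_of H I \<and> simple I}"

text \<open>\<open>H\<close> is the (internal) direct sum of its simple ideals; the empty sum is \<open>{0}\<close>.\<close>

definition strong_semisimple :: "'a set \<Rightarrow> bool" where
  "strong_semisimple H \<longleftrightarrow>
     H = span (\<Union>(simple_ideals H)) \<and>
     (\<forall>I\<in>simple_ideals H. I \<inter> span (\<Union>(simple_ideals H - {I})) = {0})"

primrec derived :: "'a set \<Rightarrow> nat \<Rightarrow> 'a set" where
  "derived I 0 = I"
| "derived I (Suc s) = bracket (replicate n (derived I s))"

definition solvable_ideal :: "'a set \<Rightarrow> bool" where
  "solvable_ideal I \<longleftrightarrow> ideal_of UNIV I \<and> (\<exists>s. derived I s = {0})"

definition is_radical :: "'a set \<Rightarrow> bool" where
  "is_radical R \<longleftrightarrow> solvable_ideal R \<and> (\<forall>I. solvable_ideal I \<longrightarrow> I \<subseteq> R)"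

definition levi_decomposition :: "'a set \<Rightarrow> 'a set \<Rightarrow> bool" where
  "levi_decomposition S R \<longleftrightarrow>
     is_radical R \<and> subalgebra S \<and> strong_semisimple S \<and> is_direct_sum UNIV S R"

text \<open>
  A minimal ideal is required to be proper. Hence a simple or one-dimensional algebra has no minimal
  ideal and its socle is \<open>{0}\<close>, although its radical is centralized by the whole algebra.
\<close>

definition minimal_ideal :: "'a set \<Rightarrow> bool" where
  "minimal_ideal I \<longleftrightarrow> ideal_of UNIV I \<and> I \<noteq> {0} \<and> I \<noteq> UNIV \<and>
     (\<forall>J. ideal_of UNIV J \<and> J \<subset> I \<longrightarrow> J = {0})"

definition Soc :: "'a set" where
  "Soc = span (\<Union>{I. minimal_ideal I})"

definition centralizer :: "'a set \<Rightarrow> 'a set" where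
  "centralizer V = {x. bracket ({x} # V # replicate (n - 2) UNIV) = {0}}"

definition center :: "'a set" where
  "center = centralizer UNIV"

end

locale metric_n_lie_algebra = n_lie_algebra scale n br
  for scale :: "complex \<Rightarrow> 'a::ab_group_add \<Rightarrow> 'a" and n :: nat and br :: "'a list \<Rightarrow> 'a" +
  fixes B :: "'a \<Rightarrow> 'a \<Rightarrow> complex"
  assumes linear_left: "\<And>y. Vector_Spaces.linear scale (*) (\<lambda>x. B x y)"
    and linear_right: "\<And>x. Vector_Spaces.linear scale (*) (\<lambda>y. B x y)"
    and symmetric: "\<And>x y. B x y = B y x"
    and nondegenerate: "\<And>x. (\<forall>y. B x y = 0) \<Longrightarrow> x = 0"
    and invariant: "\<And>xs y1 y2. length xs = n - 1 \<Longrightarrow>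
          B (br (xs @ [y1])) y2 = - B (br (xs @ [y2])) y1"
begin

definition perp :: "'a set \<Rightarrow> 'a set" where
  "perp W = {x. \<forall>w\<in>W. B w x = 0}"

end

end

theory Submission imports Defs begin

text \<open>
  Invariance turns centralizers into orthogonal complements: the centralizer of \<open>V\<close> is
  \<open>[V, G, ..., G]\<^sup>\<bottom>\<close>, and the center is \<open>[G, ..., G]\<^sup>\<bottom>\<close>. Since \<open>S\<close> is perfect,
  \<open>[R, G, ..., G] = R \<inter> [G, ..., G]\<close> and \<open>R + [G, ..., G] = G\<close>, and dualizing these two
  equations gives the direct sum decomposition of the centralizer of \<open>R\<close>.

  For the socle, \<open>I \<mapsto> I\<^sup>\<bottom>\<close> exchanges minimal and maximal ideals, and \<open>[I, I\<^sup>\<bottom>, G, ..., G] = 0\<close>.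
  If \<open>I\<close> is minimal, then \<open>R \<subseteq> I\<^sup>\<bottom>\<close>, or the solvable quotient \<open>G / I\<^sup>\<bottom>\<close> has
  no proper ideals and hence zero bracket, so that \<open>I\<close> is central; either way \<open>I\<close> centralizes \<open>R\<close>.
  Conversely, central lines are minimal ideals, and \<open>R\<^sup>\<bottom>\<close> is the sum of the minimal
  ideals dual to the maximal ideals containing \<open>R\<close>.
\<close>

section \<open>Bracket calculus: multilinearity, transpositions, spans of brackets\<close>

context n_lie_algebra
begin

lemma br_update_add:
  assumes "length xs = n" "i < n"
  shows "br (xs[i := x + y]) = br (xs[i := x]) + br (xs[i := y])"
  using multilinear[OF assms] by (simp add: Vector_Spaces.linear_iff)

lemma br_update_diff:
  assumes "length xs = n" "i < n"
  shows "br (xs[i := x - y]) = br (xs[i := x]) - br (xs[i := y])"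
  using br_update_add[OF assms, of "x - y" y] by simp

lemma br_update_scale:
  assumes "length xs = n" "i < n"
  shows "br (xs[i := scale c x]) = scale c (br (xs[i := x]))"
  using multilinear[OF assms] by (simp add: Vector_Spaces.linear_iff)

lemma br_update_zero:
  assumes "length xs = n" "i < n"
  shows "br (xs[i := 0]) = 0"
  using br_update_diff[OF assms, of 0 0] by simp

text \<open>Transpositions are the form in which skew-symmetry enters below: they carry a chosen
  argument to the slot where a hypothesis applies.\<close>

lemma br_swap:
  assumes "length xs = n" "i < n" "j < n" "i \<noteq> j"
  shows "br xs = - br (xs[i := xs ! j, j := xs ! i])"
proof -
  have "permute_list (transpose i j) xs = xs[i := xs ! j, j := xs ! i]"
    using assms by (auto intro!: nth_equalityI simp: permute_list_def nth_list_update transpose_def)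
  moreover have "transpose i j permutes {..<n}"
    using assms by (intro permutes_swap_id) auto
  ultimately show ?thesis
    using skew[OF assms(1), of "transpose i j"] assms by (simp add: sign_swap_id)
qed

lemma list_all2_mem_replicate:
  "list_all2 (\<in>) vs (replicate k H) \<longleftrightarrow> length vs = k \<and> set vs \<subseteq> H"
  by (auto simp: list_all2_conv_all_nth set_conv_nth)

lemma subspace_bracket: "subspace (bracket Vs)"
  unfolding bracket_def by (rule subspace_span)

lemma br_mem_bracket: "list_all2 (\<in>) vs Vs \<Longrightarrow> br vs \<in> bracket Vs"
  unfolding bracket_def by (blast intro: span_base)

lemma bracket_subset_iff:
  assumes "subspace W"
  shows "bracket Vs \<subseteq> W \<longleftrightarrow> (\<forall>vs. list_all2 (\<in>) vs Vs \<longrightarrow> br vs \<in> W)"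
proof
  show "bracket Vs \<subseteq> W \<Longrightarrow> \<forall>vs. list_all2 (\<in>) vs Vs \<longrightarrow> br vs \<in> W"
    using br_mem_bracket by blast
next
  assume "\<forall>vs. list_all2 (\<in>) vs Vs \<longrightarrow> br vs \<in> W"
  then show "bracket Vs \<subseteq> W"
    unfolding bracket_def by (intro span_minimal assms) blast
qed

lemma bracket_eq_0_iff: "bracket Vs = {0} \<longleftrightarrow> (\<forall>vs. list_all2 (\<in>) vs Vs \<longrightarrow> br vs = 0)"
  using bracket_subset_iff[OF subspace_single_0, of Vs] subspace_0[OF subspace_bracket, of Vs]
  by auto

section \<open>Ideals and subalgebras\<close>

lemma ideal_of_first_iff:
  "ideal_of H I \<longleftrightarrow> subspace I \<and> I \<subseteq> H \<and>
    (\<forall>x xs. x \<in> I \<longrightarrow> length xs = n - 1 \<longrightarrow> set xs \<subseteq> H \<longrightarrow> br (x # xs) \<in> I)"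
proof -
  have "bracket (I # replicate (n - 1) H) \<subseteq> I \<longleftrightarrow>
      (\<forall>x xs. x \<in> I \<longrightarrow> length xs = n - 1 \<longrightarrow> set xs \<subseteq> H \<longrightarrow> br (x # xs) \<in> I)"
    if "subspace I"
    unfolding bracket_subset_iff[OF that]
    by (auto simp: list_all2_Cons2 list_all2_mem_replicate)
  then show ?thesis
    unfolding ideal_of_def by blast
qed

text \<open>A swap moves the argument lying in \<open>I\<close> to slot 0, the slot used in the
  definition of an ideal; the sign is harmless in a subspace.\<close>

lemma ideal_of_iff:
  "ideal_of H I \<longleftrightarrow> subspace I \<and> I \<subseteq> H \<and>
    (\<forall>xs i. length xs = n \<longrightarrow> set xs \<subseteq> H \<longrightarrow> i < n \<longrightarrow> xs ! i \<in> I \<longrightarrow> br xs \<in> I)"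
  (is "_ \<longleftrightarrow> ?R")
proof
  assume I: "ideal_of H I"
  have first: "br xs \<in> I" if "length xs = n" "set xs \<subseteq> H" "xs ! 0 \<in> I" for xs
    using I that n_ge_2 by (cases xs) (auto simp: ideal_of_first_iff)
  have "br xs \<in> I" if xs: "length xs = n" "set xs \<subseteq> H" "i < n" "xs ! i \<in> I" for xs i
  proof (cases "i = 0")
    case False
    let ?ys = "xs[0 := xs ! i, i := xs ! 0]"
    have "0 < length xs" "i < length xs"
      using xs by auto
    from this[THEN nth_mem] have "xs ! 0 \<in> H" "xs ! i \<in> H"
      using xs(2) by blast+
    then have "set ?ys \<subseteq> H"
      using xs(2) by (intro set_update_subsetI)
    moreover have "?ys ! 0 \<in> I"
      using xs n_ge_2 False by simp
    ultimately have "br ?ys \<in> I"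
      using first xs by simp
    then have "- br ?ys \<in> I"
      using I by (auto simp: ideal_of_def intro: subspace_neg)
    then show ?thesis
      using br_swap[of xs 0 i] xs n_ge_2 False by simp
  qed (use first xs in blast)
  with I show ?R
    by (auto simp: ideal_of_def)
next
  assume R: ?R
  have "br (x # xs) \<in> I" if "x \<in> I" "length xs = n - 1" "set xs \<subseteq> H" for x xs
    using R[THEN conjunct2, THEN conjunct2, rule_format, of "x # xs" 0] R that n_ge_2 by auto
  with R show "ideal_of H I"
    by (simp add: ideal_of_first_iff)
qed

lemma br_mem_ideal:
  assumes "ideal_of UNIV I" "length xs = n" "i < n" "xs ! i \<in> I"
  shows "br xs \<in> I"
  using assms unfolding ideal_of_iff by blast

lemma ideal_of_subspace: "ideal_of H I \<Longrightarrow> subspace I"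
  by (simp add: ideal_of_def)

lemma ideal_of_Int_subalgebra:
  assumes "ideal_of UNIV J" "subalgebra H"
  shows "ideal_of H (J \<inter> H)"
  unfolding ideal_of_iff
  using assms br_mem_ideal[OF assms(1)]
  by (auto simp: subalgebra_def ideal_of_def subspace_inter bracket_subset_iff
      list_all2_mem_replicate)

lemma subalgebra_ideal_of:
  assumes "ideal_of H I"
  shows "subalgebra I"
proof -
  have "br xs \<in> I" if "length xs = n" "set xs \<subseteq> I" for xs
  proof -
    have "xs ! 0 \<in> set xs"
      using that n_ge_2 by (intro nth_mem) auto
    then have "xs ! 0 \<in> I" "set xs \<subseteq> H"
      using that assms by (auto simp: ideal_of_def)
    then show ?thesis
      using assms that n_ge_2 unfolding ideal_of_iff by (metis less_le_trans zero_less_numeral)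
  qed
  then show ?thesis
    using ideal_of_subspace[OF assms]
    by (simp add: subalgebra_def bracket_subset_iff list_all2_mem_replicate)
qed

lemma ideal_of_span_Union:
  assumes "\<And>I. I \<in> F \<Longrightarrow> ideal_of H I" "subspace H"
  shows "ideal_of H (span (\<Union>F))"
  unfolding ideal_of_first_iff
proof (intro conjI allI impI)
  show "span (\<Union>F) \<subseteq> H"
    using assms by (intro span_minimal) (auto simp: ideal_of_def)
next
  fix x xs
  assume x: "x \<in> span (\<Union>F)" and xs: "length xs = n - 1" "set xs \<subseteq> H"
  \<comment> \<open>The first argument is written as a list update, since multilinearity is stated
    for updates; the placeholder 0 is always overwritten.\<close>
  let ?L = "\<lambda>y. (0 # xs)[0 := y]"
  have len: "length (0 # xs) = n" "0 < n"
    using xs n_ge_2 by auto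
  from x have "br (?L x) \<in> span (\<Union>F)"
  proof (induction rule: span_induct_alt)
    case base
    then show ?case
      using br_update_zero[OF len] by (simp add: span_zero)
  next
    case (step c y z)
    then obtain I where "I \<in> F" "y \<in> I"
      by blast
    then have "br (?L y) \<in> I"
      using assms(1)[of I] xs unfolding ideal_of_first_iff by auto
    with \<open>I \<in> F\<close> have "br (?L y) \<in> span (\<Union>F)"
      by (intro span_base) blast
    with step show ?case
      unfolding br_update_add[OF len] br_update_scale[OF len]
      by (intro span_add span_scale)
  qed
  then show "br (x # xs) \<in> span (\<Union>F)"
    by simp
qed simp

section \<open>Computing brackets modulo an ideal\<close>

text \<open>Exchange \<open>xs\<close> for \<open>ys\<close> one slot at a time. Each exchange
  changes the bracket by a bracket with an entry in \<open>J\<close>, hence by an element of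
  \<open>W\<close>.\<close>

lemma br_cong_mod:
  assumes len: "length xs = n" "length ys = n"
    and diff: "\<And>i. i < n \<Longrightarrow> xs ! i - ys ! i \<in> J"
    and W: "subspace W"
    and br: "\<And>zs i. length zs = n \<Longrightarrow> i < n \<Longrightarrow> zs ! i \<in> J \<Longrightarrow> br zs \<in> W"
  shows "br xs - br ys \<in> W"
proof -
  have "br xs - br (take k ys @ drop k xs) \<in> W" if "k \<le> n" for k
    using that
  proof (induction k)
    case 0
    then show ?case
      using W by (simp add: subspace_0)
  next
    case (Suc k)
    let ?zs = "take k ys @ drop k xs"
    have k: "k < n" and zs: "length ?zs = n"
      using Suc.prems len by auto
    \<comment> \<open>Two consecutive hybrid lists are updates of the same list in slot
      \<open>k\<close>, so the difference of their brackets is a single bracket.\<close>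
    have 1: "?zs[k := xs ! k] = ?zs"
      using k len by (intro list_update_same_conv[THEN iffD2]) (auto simp: nth_append)
    have 2: "?zs[k := ys ! k] = take (Suc k) ys @ drop (Suc k) xs"
      using k len
      by (intro nth_equalityI) (auto simp: nth_list_update nth_append less_Suc_eq)
    have "br (?zs[k := xs ! k - ys ! k]) \<in> W"
      using k zs diff by (intro br[of _ k]) auto
    then have "br ?zs - br (take (Suc k) ys @ drop (Suc k) xs) \<in> W"
      unfolding br_update_diff[OF zs k] 1 2 .
    from subspace_add[OF W Suc.IH this] show ?case
      using k by simp
  qed
  from this[of n] show ?thesis
    using len by simp
qed

text \<open>Replace every argument by a representative in \<open>H\<close> modulo \<open>J\<close>.
  This is applied with \<open>H\<close> a Levi subalgebra and with \<open>H\<close> a term of the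
  derived series of the radical.\<close>

lemma bracket_decompose_mod:
  assumes H: "\<And>x. \<exists>h\<in>H. x - h \<in> J"
    and W: "subspace W"
    and br: "\<And>zs i. length zs = n \<Longrightarrow> i < n \<Longrightarrow> zs ! i \<in> J \<Longrightarrow> br zs \<in> W"
  shows "bracket (replicate n UNIV) \<subseteq> {h + w | h w. h \<in> bracket (replicate n H) \<and> w \<in> W}"
proof -
  obtain f where f: "\<And>x. f x \<in> H" "\<And>x. x - f x \<in> J"
    using H by metis
  have "\<exists>h w. br xs = h + w \<and> h \<in> bracket (replicate n H) \<and> w \<in> W" if len: "length xs = n" for xs
  proof (intro exI conjI)
    show "br xs = br (map f xs) + (br xs - br (map f xs))"
      by simp
    show "br xs - br (map f xs) \<in> W"
      using len f by (intro br_cong_mod[where J = J] W br) auto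
    show "br (map f xs) \<in> bracket (replicate n H)"
      using len f by (intro br_mem_bracket) (auto simp: list_all2_mem_replicate)
  qed
  then show ?thesis
    using W
    by (auto simp: bracket_subset_iff subspace_sums subspace_bracket list_all2_mem_replicate)
qed

lemma ideal_of_sum:
  assumes I: "ideal_of UNIV I" and J: "ideal_of UNIV J"
  shows "ideal_of UNIV {x + y | x y. x \<in> I \<and> y \<in> J}"
proof -
  have "ideal_of UNIV (span (\<Union>{I, J}))"
    using I J by (intro ideal_of_span_Union) auto
  moreover have "span I = I" "span J = J"
    using ideal_of_subspace I J by auto
  ultimately show ?thesis
    by (simp add: span_Un)
qed

lemma derived_algebra_ideal: "ideal_of UNIV (bracket (replicate n UNIV))"
  unfolding ideal_of_first_iff using n_ge_2
  by (auto simp: subspace_bracket intro!: br_mem_bracket simp: list_all2_mem_replicate)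

section \<open>Perfectness of strong semisimple subalgebras\<close>

text \<open>The derived algebra of \<open>I\<close> is an ideal of \<open>I\<close>, and simplicity
  excludes that it vanishes.\<close>

lemma bracket_simple:
  assumes "simple I" "ideal_of H I"
  shows "bracket (replicate n I) = I"
proof -
  have sub: "bracket (replicate n I) \<subseteq> I"
    using subalgebra_ideal_of[OF assms(2)] by (simp add: subalgebra_def)
  then have "ideal_of I (bracket (replicate n I))"
    unfolding ideal_of_first_iff using n_ge_2
    by (auto simp: subspace_bracket intro!: br_mem_bracket simp: list_all2_mem_replicate)
  then show ?thesis
    using assms by (auto simp: simple_def)
qed

text \<open>Each simple ideal equals its own derived algebra, and the simple ideals span
  \<open>H\<close>.\<close>

lemma strong_semisimple_perfect:
  assumes "strong_semisimple H"
  shows "H \<subseteq> bracket (replicate n UNIV)"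
proof -
  have "\<Union>(simple_ideals H) \<subseteq> bracket (replicate n UNIV)"
  proof (rule Union_least)
    fix I
    assume "I \<in> simple_ideals H"
    then have "I = bracket (replicate n I)"
      by (auto simp: simple_ideals_def bracket_simple)
    also have "\<dots> \<subseteq> bracket (replicate n UNIV)"
      by (auto simp: bracket_subset_iff subspace_bracket list_all2_mem_replicate
          intro!: br_mem_bracket)
    finally show "I \<subseteq> bracket (replicate n UNIV)" .
  qed
  then have "span (\<Union>(simple_ideals H)) \<subseteq> bracket (replicate n UNIV)"
    by (intro span_minimal subspace_bracket)
  then show ?thesis
    using assms by (simp add: strong_semisimple_def)
qed

section \<open>Centralizers and independent families of subspaces\<close>

lemma centralizer_iff:
  "x \<in> centralizer V \<longleftrightarrow> (\<forall>xs. length xs = n \<longrightarrow> xs ! 0 = x \<longrightarrow> xs ! 1 \<in> V \<longrightarrow> br xs = 0)"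
proof -
  have "list_all2 (\<in>) xs ({x} # V # replicate (n - 2) UNIV)
      \<longleftrightarrow> length xs = n \<and> xs ! 0 = x \<and> xs ! 1 \<in> V" for xs
    using n_ge_2 by (cases xs; cases "tl xs") (auto simp: list_all2_mem_replicate)
  then show ?thesis
    unfolding centralizer_def by (auto simp: bracket_eq_0_iff)
qed

text \<open>Assign to each vector of a linear combination one member of \<open>F\<close> containing
  it and group the terms accordingly; this leaves one summand per subspace.\<close>

lemma span_Union_subspaces:
  assumes x: "x \<in> span (\<Union>F)" and F: "\<And>U. U \<in> F \<Longrightarrow> subspace U"
  obtains T f where "finite T" "T \<subseteq> F" "\<And>U. U \<in> T \<Longrightarrow> f U \<in> U" "x = sum f T"
proof -
  obtain t r where t: "finite t" "t \<subseteq> \<Union>F" and x: "x = (\<Sum>a\<in>t. scale (r a) a)"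
    using x by (auto simp: span_explicit)
  have "\<forall>a\<in>t. \<exists>U\<in>F. a \<in> U"
    using t by blast
  then obtain g where g: "\<And>a. a \<in> t \<Longrightarrow> g a \<in> F \<and> a \<in> g a"
    by metis
  show ?thesis
  proof
    show "finite (g ` t)" "g ` t \<subseteq> F"
      using t g by auto
    show "(\<Sum>a\<in>{a \<in> t. g a = U}. scale (r a) a) \<in> U" if "U \<in> g ` t" for U
      using that g F by (intro subspace_sum subspace_scale) auto
    show "x = (\<Sum>U\<in>g ` t. \<Sum>a\<in>{a \<in> t. g a = U}. scale (r a) a)"
      unfolding x by (rule sum.image_gen[OF t(1)])
  qed
qed

text \<open>In an expansion of \<open>x\<close>, the component in \<open>U\<close> is
  \<open>x\<close> minus the other components, so it lies both in \<open>U\<close> and in the span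
  of the other subspaces. For empty \<open>F\<close> the information comes from
  \<open>x \<in> span (\<Union>F)\<close> alone.\<close>

lemma independent_subspaces_Inter:
  assumes F: "\<And>U. U \<in> F \<Longrightarrow> subspace U"
    and indep: "\<And>U. U \<in> F \<Longrightarrow> U \<inter> span (\<Union>(F - {U})) = {0}"
    and x: "x \<in> span (\<Union>F)" "\<And>U. U \<in> F \<Longrightarrow> x \<in> span (\<Union>(F - {U}))"
  shows "x = 0"
proof -
  obtain T f where T: "finite T" "T \<subseteq> F" and f: "\<And>U. U \<in> T \<Longrightarrow> f U \<in> U" and xf: "x = sum f T"
    using span_Union_subspaces[OF x(1) F] by metis
  have "f U = 0" if U: "U \<in> T" for U
  proof -
    have "sum f (T - {U}) \<in> span (\<Union>(F - {U}))"
      using T f by (intro span_sum span_base) blast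
    moreover have "f U = x - sum f (T - {U})"
      using xf T U by (simp add: sum.remove)
    ultimately have "f U \<in> span (\<Union>(F - {U}))"
      using x(2) T U by (auto intro: span_diff)
    then show ?thesis
      using indep f U T by blast
  qed
  then show ?thesis
    using xf by simp
qed

end

section \<open>The bilinear form and orthogonal complements\<close>

context metric_n_lie_algebra
begin

lemma vector_space_complex: "vector_space ((*) :: complex \<Rightarrow> complex \<Rightarrow> complex)"
  using linear_left by (simp add: Vector_Spaces.linear_iff)

lemma B_add_left: "B (x + y) z = B x z + B y z"
  using linear_left[of z] by (simp add: Vector_Spaces.linear_iff)

lemma B_add_right: "B z (x + y) = B z x + B z y"
  using linear_right[of z] by (simp add: Vector_Spaces.linear_iff)

lemma B_scale_left: "B (scale c x) z = c * B x z"
  using linear_left[of z] by (simp add: Vector_Spaces.linear_iff)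

lemma B_scale_right: "B z (scale c x) = c * B z x"
  using linear_right[of z] by (simp add: Vector_Spaces.linear_iff)

lemma B_zero_left: "B 0 z = 0"
  using B_scale_left[of 0 0 z] by simp

lemma B_zero_right: "B z 0 = 0"
  using symmetric B_zero_left by metis

lemma B_minus_left: "B (- x) z = - B x z"
  using B_scale_left[of "-1" x z] by simp

lemma B_diff_left: "B (x - y) z = B x z - B y z"
  using B_add_left[of x "- y" z] by (simp add: B_minus_left)

lemma subspace_perp: "subspace (perp W)"
  by (auto simp: perp_def subspace_def B_add_right B_scale_right B_zero_right)

lemma perp_mono: "U \<subseteq> W \<Longrightarrow> perp W \<subseteq> perp U"
  by (auto simp: perp_def)

lemma perp_UNIV: "perp UNIV = {0}"
  using nondegenerate symmetric unfolding perp_def by (auto simp: B_zero_right)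

lemma perp_span: "perp (span X) = perp X"
proof
  show "perp (span X) \<subseteq> perp X"
    by (intro perp_mono span_superset)
  show "perp X \<subseteq> perp (span X)"
  proof
    fix y
    assume y: "y \<in> perp X"
    have "B w y = 0" if "w \<in> span X" for w
      using that
      by (induction rule: span_induct_alt)
        (use y in \<open>auto simp: perp_def B_add_left B_scale_left B_zero_left\<close>)
    then show "y \<in> perp (span X)"
      by (simp add: perp_def)
  qed
qed

text \<open>Nondegeneracy makes the map from vectors to functionals injective, and finite dimension
  makes it surjective.\<close>

lemma functional_eq_B:
  assumes f: "Vector_Spaces.linear scale (*) f"
  obtains y where "\<And>x. B y x = f x"
proof -
  obtain A where A: "finite A" "span A = UNIV"
    using finite_dim by blast
  obtain E where E: "E \<subseteq> A" "independent E" "A \<subseteq> span E"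
    using maximal_independent_subset by blast
  have fin: "finite E" and spanE: "span E = UNIV"
    using A E span_minimal[OF E(3)] finite_subset by auto
  interpret fd: finite_dimensional_vector_space scale E
    by unfold_locales (use fin E spanE in auto)
  interpret vector_space_pair scale "(*) :: complex \<Rightarrow> complex \<Rightarrow> complex"
    by (intro vector_space_pair.intro vector_space_complex vector_space_axioms)
  have uniq: "B y x = g x"
    if "Vector_Spaces.linear scale (*) g" "\<And>b. b \<in> E \<Longrightarrow> B y b = g b" for y g x
    by (rule linear_eq_on[OF linear_right that(1), of x E]) (use that spanE in auto)
  have coeff: "c b = d b"
    if "(\<Sum>b\<in>E. scale (c b) b) = (\<Sum>b\<in>E. scale (d b) b)" "b \<in> E" for c d b
    using independentD[OF E(2) fin order_refl, of "\<lambda>b. c b - d b" b] that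
    by (simp add: scale_left_diff_distrib sum_subtractf)
  \<comment> \<open>\<open>T y\<close> records the values of \<open>B y\<close> on the basis
    \<open>E\<close> as coordinates in the same space. Thus \<open>T\<close> is an endomorphism, for
    which injectivity implies surjectivity.\<close>
  define T where "T y = (\<Sum>b\<in>E. scale (B y b) b)" for y
  have "Vector_Spaces.linear scale scale T"
    by (simp add: Vector_Spaces.linear_iff vector_space_axioms T_def B_add_left B_scale_left
        scale_left_distrib sum.distrib scale_sum_right)
  moreover have "inj T"
  proof (rule injI)
    fix y z
    assume "T y = T z"
    then have "B y b = B z b" if "b \<in> E" for b
      using coeff that unfolding T_def by blast
    then have "B y x = B z x" for x
      by (rule uniq[OF linear_right])
    then show "y = z"
      using nondegenerate[of "y - z"] by (simp add: B_diff_left)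
  qed
  ultimately have "surj T"
    by (rule fd.linear_inj_imp_surj)
  then obtain y where "T y = (\<Sum>b\<in>E. scale (f b) b)"
    by (metis surjD)
  then have "B y b = f b" if "b \<in> E" for b
    using coeff that unfolding T_def by blast
  then have "B y x = f x" for x
    by (rule uniq[OF f])
  then show ?thesis
    by (rule that)
qed

text \<open>A vector \<open>x\<close> outside \<open>W\<close> is separated from \<open>W\<close> by
  a functional that is 0 on a basis of \<open>W\<close> and 1 at \<open>x\<close>. The vector
  representing it lies in \<open>perp W\<close> but is not orthogonal to \<open>x\<close>.\<close>

lemma perp_perp:
  assumes W: "subspace W"
  shows "perp (perp W) = W"
proof
  show "W \<subseteq> perp (perp W)"
    using symmetric by (auto simp: perp_def)
  show "perp (perp W) \<subseteq> W"
  proof (rule ccontr)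
    assume "\<not> perp (perp W) \<subseteq> W"
    then obtain x where x: "x \<in> perp (perp W)" "x \<notin> W"
      by blast
    interpret vector_space_pair scale "(*) :: complex \<Rightarrow> complex \<Rightarrow> complex"
      by (intro vector_space_pair.intro vector_space_complex vector_space_axioms)
    obtain C where C: "C \<subseteq> W" "independent C" "W \<subseteq> span C"
      using maximal_independent_subset by blast
    then have spanC: "span C = W"
      using W by (intro span_subspace)
    then have "independent (insert x C)"
      using x C by (simp add: independent_insertI)
    then obtain g where g: "Vector_Spaces.linear scale (*) g"
      "\<forall>z\<in>insert x C. g z = (if z = x then 1 else 0)"
      using linear_independent_extend[of "insert x C" "\<lambda>z. if z = x then 1 else 0"] by blast
    obtain y where y: "\<And>z. B y z = g z"
      using functional_eq_B[OF g(1)] by blast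
    have "\<forall>c\<in>C. B c y = 0"
      using g(2) y symmetric x C by (metis insertCI subsetD)
    then have "y \<in> perp C"
      by (simp add: perp_def)
    then have "y \<in> perp W"
      using spanC perp_span by metis
    then have "B y x = 0"
      using x by (simp add: perp_def)
    then show False
      using g(2) y by simp
  qed
qed

text \<open>The complement of the sum on the right lies in both double complements, hence in
  \<open>U \<inter> W\<close>; taking complements once more gives the nontrivial inclusion.\<close>

lemma perp_Int:
  assumes "subspace U" "subspace W"
  shows "perp (U \<inter> W) = {u + w | u w. u \<in> perp U \<and> w \<in> perp W}" (is "_ = ?X")
proof -
  have "perp U \<subseteq> ?X" "perp W \<subseteq> ?X"
    using subspace_0[OF subspace_perp] by force+
  then have "perp ?X \<subseteq> U \<inter> W"
    using perp_mono assms perp_perp by blast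
  then have "perp (U \<inter> W) \<subseteq> perp (perp ?X)"
    by (rule perp_mono)
  also have "\<dots> = ?X"
    by (intro perp_perp subspace_sums subspace_perp)
  finally show ?thesis
    by (auto simp: perp_def B_add_right)
qed

section \<open>Invariance: ideals and centralizers under complements\<close>

text \<open>A swap carries slot \<open>i\<close> to the last slot, where \<open>invariant\<close>
  applies, and a second swap carries it back. The signs of the swaps cancel and the sign of
  invariance remains.\<close>

lemma B_br:
  assumes xs: "length xs = n" "i < n"
  shows "B (br xs) y = - B (br (xs[i := y])) (xs ! i)"
proof -
  define m where "m = n - 1"
  have m: "m < n" "n = Suc m"
    using n_ge_2 by (auto simp: m_def)
  have last: "B (br zs) y = - B (br (zs[m := y])) (zs ! m)" if "length zs = n" for zs
  proof -
    have "zs = take m zs @ [zs ! m]" "zs[m := y] = take m zs @ [y]"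
      using that m by (auto simp: take_Suc_conv_app_nth[symmetric] upd_conv_take_nth_drop)
    then show ?thesis
      using invariant[of "take m zs" "zs ! m" y] that m by simp
  qed
  show ?thesis
  proof (cases "i = m")
    case False
    let ?zs = "xs[i := xs ! m, m := xs ! i]"
    have "B (br xs) y = - B (br ?zs) y"
      using br_swap[OF xs(1) xs(2) m(1) False] by (simp add: B_minus_left)
    also have "\<dots> = B (br (?zs[m := y])) (xs ! i)"
      using last[of ?zs] xs m by simp
    also have "br (?zs[m := y]) = - br (xs[i := y])"
      using br_swap[of "xs[i := y]" i m] xs m False by simp
    finally show ?thesis
      by (simp add: B_minus_left)
  qed (use last xs in blast)
qed

text \<open>Invariance moves \<open>z \<in> I\<close> into the bracket in exchange for the entry in
  \<open>perp I\<close>; the new bracket lies in \<open>I\<close> and is therefore orthogonal to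
  that entry.\<close>

lemma ideal_perp:
  assumes I: "ideal_of UNIV I"
  shows "ideal_of UNIV (perp I)"
  unfolding ideal_of_iff
proof (intro conjI allI impI)
  fix xs i
  assume xs: "length xs = n" "i < n" "xs ! i \<in> perp I"
  have "B z (br xs) = 0" if "z \<in> I" for z
  proof -
    have "br (xs[i := z]) \<in> I"
      using xs that by (intro br_mem_ideal[OF I, of _ i]) auto
    then show ?thesis
      using B_br[OF xs(1,2), of z] xs(3) symmetric[of z] symmetric[of "xs ! i"]
      by (simp add: perp_def)
  qed
  then show "br xs \<in> perp I"
    by (simp add: perp_def)
qed (simp_all add: subspace_perp)

text \<open>Pair the bracket with \<open>y\<close> and exchange \<open>y\<close> for the entry in
  \<open>I\<close>. The new bracket still has an entry in \<open>perp I\<close>, so it is orthogonal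
  to the entry taken out.\<close>

lemma br_ideal_perp:
  assumes I: "ideal_of UNIV I" and xs: "length xs = n" "i < n" "j < n" "i \<noteq> j"
    and mem: "xs ! i \<in> I" "xs ! j \<in> perp I"
  shows "br xs = 0"
proof (rule nondegenerate, rule allI)
  fix y
  have "br (xs[i := y]) \<in> perp I"
    using xs mem by (intro br_mem_ideal[OF ideal_perp[OF I], of _ j]) auto
  then show "B (br xs) y = 0"
    using B_br[OF xs(1,2), of y] mem symmetric by (simp add: perp_def)
qed

text \<open>Invariance exchanges \<open>x\<close> with the free argument in slot 0 and leaves the
  argument from \<open>V\<close> in slot 1; nondegeneracy then turns orthogonality to all such
  brackets into vanishing.\<close>

lemma centralizer_eq_perp: "centralizer V = perp {br xs | xs. length xs = n \<and> xs ! 1 \<in> V}"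
proof (intro equalityI subsetI)
  fix x
  assume x: "x \<in> centralizer V"
  have "B (br xs) x = 0" if "length xs = n" "xs ! 1 \<in> V" for xs
  proof -
    have "br (xs[0 := x]) = 0"
      using x that n_ge_2 by (simp add: centralizer_iff)
    then show ?thesis
      using B_br[of xs 0 x] that n_ge_2 by (simp add: B_zero_left)
  qed
  then show "x \<in> perp {br xs | xs. length xs = n \<and> xs ! 1 \<in> V}"
    by (auto simp: perp_def)
next
  fix x
  assume x: "x \<in> perp {br xs | xs. length xs = n \<and> xs ! 1 \<in> V}"
  show "x \<in> centralizer V"
    unfolding centralizer_iff
  proof (intro allI impI)
    fix xs
    assume xs: "length xs = n" "xs ! 0 = x" "xs ! 1 \<in> V"
    have "B (br (xs[0 := y])) x = 0" for y
    proof -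
      have "length (xs[0 := y]) = n \<and> xs[0 := y] ! 1 \<in> V"
        using xs n_ge_2 by simp
      then show ?thesis
        using x unfolding perp_def by blast
    qed
    then show "br xs = 0"
      using xs n_ge_2 B_br[of xs 0] by (intro nondegenerate) simp
  qed
qed

lemma subspace_centralizer: "subspace (centralizer V)"
  unfolding centralizer_eq_perp by (rule subspace_perp)

lemma center_eq_perp: "center = perp (bracket (replicate n UNIV))"
  unfolding center_def centralizer_eq_perp bracket_def
  by (simp add: list_all2_mem_replicate perp_span)

lemma center_subset_centralizer: "center \<subseteq> centralizer V"
  by (auto simp: center_def centralizer_iff)

lemma ideal_perp_perp: "ideal_of UNIV I \<Longrightarrow> perp (perp I) = I"
  by (intro perp_perp ideal_of_subspace)

section \<open>Minimal ideals and their dual maximal ideals\<close>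

text \<open>The ideal \<open>perp K\<close> lies inside \<open>I\<close>, so by minimality it is
  \<open>I\<close> or zero; the double complement recovers \<open>K\<close>.\<close>

lemma perp_minimal_ideal_maximal:
  assumes I: "minimal_ideal I" and K: "ideal_of UNIV K" "perp I \<subseteq> K"
  shows "K = perp I \<or> K = UNIV"
proof -
  have "perp K \<subseteq> I"
    using perp_mono[OF K(2)] I ideal_perp_perp by (simp add: minimal_ideal_def)
  then have "perp K = I \<or> perp K = {0}"
    using I ideal_perp[OF K(1)] by (auto simp: minimal_ideal_def)
  moreover have "perp {0} = UNIV"
    by (simp add: perp_def B_zero_left)
  ultimately show ?thesis
    using ideal_perp_perp[OF K(1)] by auto
qed

text \<open>Here \<open>M \<noteq> {0}\<close> makes \<open>perp M\<close> proper, as the definition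
  of a minimal ideal demands, and \<open>M \<noteq> UNIV\<close> makes it nonzero.\<close>

lemma perp_maximal_ideal_minimal:
  assumes M: "ideal_of UNIV M" "M \<noteq> {0}" "M \<noteq> UNIV"
    and max: "\<And>K. ideal_of UNIV K \<Longrightarrow> M \<subseteq> K \<Longrightarrow> K = M \<or> K = UNIV"
  shows "minimal_ideal (perp M)"
  unfolding minimal_ideal_def
proof (intro conjI allI impI)
  have perp_0: "perp {0} = UNIV"
    by (simp add: perp_def B_zero_left)
  show "perp M \<noteq> {0}" "perp M \<noteq> UNIV"
    using M ideal_perp_perp[OF M(1)] perp_0 perp_UNIV by auto
  fix J
  assume J: "ideal_of UNIV J \<and> J \<subset> perp M"
  then have "M \<subseteq> perp J"
    using perp_mono[of J "perp M"] ideal_perp_perp[OF M(1)] by auto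
  then have "perp J = M \<or> perp J = UNIV"
    using max ideal_perp J by blast
  then show "J = {0}"
    using J ideal_perp_perp[of J] perp_UNIV by auto
qed (rule ideal_perp[OF M(1)])

lemma minimal_ideal_subset_centralizer:
  assumes I: "minimal_ideal I" and R: "solvable_ideal R"
  shows "I \<subseteq> centralizer R"
proof -
  have ideals: "ideal_of UNIV I" "ideal_of UNIV (perp I)" "ideal_of UNIV R"
    using I R ideal_perp by (auto simp: minimal_ideal_def solvable_ideal_def)
  let ?sum = "\<lambda>K. {x + y | x y. x \<in> K \<and> y \<in> perp I}"
  have sum: "K \<subseteq> perp I \<or> ?sum K = UNIV" if K: "ideal_of UNIV K" for K
  proof -
    have "0 \<in> K" "0 \<in> perp I"
      using K ideals(2) ideal_of_subspace subspace_0 by blast+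
    then have *: "K \<subseteq> ?sum K" "perp I \<subseteq> ?sum K"
      by force+
    have "?sum K = perp I \<or> ?sum K = UNIV"
      by (rule perp_minimal_ideal_maximal[OF I ideal_of_sum[OF K ideals(2)] *(2)])
    then show ?thesis
    proof
      assume "?sum K = perp I"
      from *(1)[unfolded this] show ?thesis
        by (rule disjI1)
    qed (rule disjI2)
  qed
  \<comment> \<open>Since \<open>perp I\<close> is a maximal ideal, \<open>R\<close> and the derived
    algebra are each either contained in it or complete it to the whole algebra.\<close>
  from sum[OF ideals(3)] sum[OF derived_algebra_ideal]
  consider "R \<subseteq> perp I" | "bracket (replicate n UNIV) \<subseteq> perp I"
    | "?sum R = UNIV" "?sum (bracket (replicate n UNIV)) = UNIV"
    by blast
  then show ?thesis
  proof cases
    case 1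
    show ?thesis
    proof
      fix x
      assume "x \<in> I"
      then show "x \<in> centralizer R"
        unfolding centralizer_iff
        using 1 n_ge_2 br_ideal_perp[OF ideals(1), of _ 0 1] by auto
    qed
  next
    case 2
    then have "I \<subseteq> center"
      using perp_mono[OF 2] ideal_perp_perp[OF ideals(1)] by (simp add: center_eq_perp)
    then show ?thesis
      using center_subset_centralizer by blast
  next
    case 3
    \<comment> \<open>In this case the quotient by \<open>perp I\<close> is perfect and is the image
      of \<open>R\<close>, so every term of the derived series of \<open>R\<close> maps onto it.
      Solvability then forces the quotient to be zero.\<close>
    have "\<exists>h\<in>derived R s. x - h \<in> perp I" for s x
    proof (induction s arbitrary: x)
      case 0
      obtain a b where "x = a + b" "a \<in> R" "b \<in> perp I"
        using 3(1) by blast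
      then show ?case
        by (intro bexI[of _ a]) auto
    next
      case (Suc s)
      obtain a b where ab: "x = a + b" "a \<in> bracket (replicate n UNIV)" "b \<in> perp I"
        using 3(2) by blast
      have "bracket (replicate n UNIV)
          \<subseteq> {h + w | h w. h \<in> bracket (replicate n (derived R s)) \<and> w \<in> perp I}"
        by (rule bracket_decompose_mod[OF Suc.IH subspace_perp]) (rule br_mem_ideal[OF ideals(2)])
      then obtain h w where hw: "a = h + w" "h \<in> derived R (Suc s)" "w \<in> perp I"
        using ab(2) by auto
      have "w + b \<in> perp I"
        using hw ab by (intro subspace_add subspace_perp)
      then show ?case
        using ab hw by (intro bexI[of _ h]) (auto simp: add.assoc)
    qed
    moreover obtain s where "derived R s = {0}"
      using R by (auto simp: solvable_ideal_def)
    ultimately have "perp I = UNIV"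
      by (metis UNIV_eq_I diff_zero singletonD)
    then have "I = {0}"
      using ideal_perp_perp[OF ideals(1)] perp_UNIV by metis
    then show ?thesis
      using I by (simp add: minimal_ideal_def)
  qed
qed

lemma minimal_ideal_subset_Soc: "minimal_ideal I \<Longrightarrow> I \<subseteq> Soc"
  unfolding Soc_def by (blast intro: span_base)

lemma center_subset_Soc:
  assumes dim: "dim UNIV \<noteq> 1"
  shows "center \<subseteq> Soc"
proof
  fix x
  assume x: "x \<in> center"
  show "x \<in> Soc"
  proof (cases "x = 0")
    case False
    have sub: "span {x} \<subseteq> center"
      using x by (intro span_minimal) (auto simp: center_def subspace_centralizer)
    have "minimal_ideal (span {x})"
      unfolding minimal_ideal_def
    proof (intro conjI allI impI)
      have "br (y # ys) = 0" if "y \<in> center" "length ys = n - 1" for y ys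
        using that n_ge_2 by (auto simp: center_def centralizer_iff)
      then show "ideal_of UNIV (span {x})"
        using sub unfolding ideal_of_first_iff by (auto simp: span_zero)
      show "span {x} \<noteq> {0}"
        using False span_base by blast
      \<comment> \<open>A central line fills the algebra only in dimension one.\<close>
      show "span {x} \<noteq> UNIV"
        using dim dim_span_eq_card_independent[of "{x}"] False
        by (auto simp del: dim_span)
      fix J
      assume J: "ideal_of UNIV J \<and> J \<subset> span {x}"
      show "J = {0}"
      proof (rule ccontr)
        assume "J \<noteq> {0}"
        then obtain y where y: "y \<in> J" "y \<noteq> 0"
          using J subspace_0[of J] by (auto simp: ideal_of_def)
        then obtain c where "y = scale c x" "c \<noteq> 0"
          using J by (auto simp: span_singleton)
        then have "x = scale (1 / c) y"
          by simp
        then have "x \<in> J"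
          using J y by (auto simp: ideal_of_def intro: subspace_scale)
        then have "span {x} \<subseteq> J"
          using J by (intro span_minimal) (auto simp: ideal_of_def)
        then show False
          using J by blast
      qed
    qed
    then show ?thesis
      using minimal_ideal_subset_Soc span_base by blast
  qed (simp add: Soc_def span_zero)
qed

section \<open>Levi decomposition: the centralizer of the radical and the socle\<close>

lemma levi_decomposition_cases:
  assumes "levi_decomposition S R"
  obtains s r where "x = s + r" "s \<in> S" "r \<in> R"
  using assms unfolding levi_decomposition_def is_direct_sum_def by blast

lemma levi_decomposition_mod:
  assumes "levi_decomposition S R"
  shows "\<exists>s\<in>S. x - s \<in> R"
proof -
  obtain s r where "x = s + r" "s \<in> S" "r \<in> R"
    using levi_decomposition_cases[OF assms] .
  then show ?thesis
    by (intro bexI[of _ s]) auto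
qed

lemma levi_decomposition_facts:
  assumes "levi_decomposition S R"
  shows "ideal_of UNIV R" "solvable_ideal R" "subspace R" "subspace S" "S \<inter> R = {0}"
    "subalgebra S" "strong_semisimple S"
  using assms by (auto simp: levi_decomposition_def is_direct_sum_def is_radical_def
      solvable_ideal_def subalgebra_def dest: ideal_of_subspace)

text \<open>Modulo brackets with an entry in \<open>R\<close>, every bracket is one of elements of
  \<open>S\<close>. For an element of \<open>R\<close> the part from \<open>S\<close> lies in
  \<open>S \<inter> R\<close>, hence vanishes. The generators have the shape required by
  \<open>centralizer_eq_perp\<close>.\<close>

lemma radical_Int_derived_algebra:
  assumes levi: "levi_decomposition S R"
  shows "R \<inter> bracket (replicate n UNIV) = span {br xs | xs. length xs = n \<and> xs ! 1 \<in> R}"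
    (is "_ = span ?D")
proof
  note facts = levi_decomposition_facts[OF levi]
  have "br xs \<in> R \<inter> bracket (replicate n UNIV)" if "length xs = n" "xs ! 1 \<in> R" for xs
    using that n_ge_2 br_mem_ideal[OF facts(1), of xs 1]
    by (auto intro: br_mem_bracket simp: list_all2_mem_replicate)
  then show "span ?D \<subseteq> R \<inter> bracket (replicate n UNIV)"
    using facts by (intro span_minimal subspace_inter subspace_bracket) auto
  then have DR: "span ?D \<subseteq> R"
    by blast
  have "br zs \<in> span ?D" if zs: "length zs = n" "i < n" "zs ! i \<in> R" for zs i
  proof (cases "i = 1")
    case False
    have "br (zs[1 := zs ! i, i := zs ! 1]) \<in> span ?D"
      using zs n_ge_2 False by (intro span_base) auto
    then show ?thesis
      using br_swap[of zs 1 i] zs n_ge_2 False by (simp add: span_neg)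
  qed (use zs in \<open>auto intro: span_base\<close>)
  then have sub: "bracket (replicate n UNIV)
      \<subseteq> {h + w | h w. h \<in> bracket (replicate n S) \<and> w \<in> span ?D}"
    by (intro bracket_decompose_mod[where J = R] levi_decomposition_mod[OF levi]) auto
  show "R \<inter> bracket (replicate n UNIV) \<subseteq> span ?D"
  proof
    fix x
    assume x: "x \<in> R \<inter> bracket (replicate n UNIV)"
    then obtain h w where hw: "x = h + w" "h \<in> bracket (replicate n S)" "w \<in> span ?D"
      using sub by blast
    then have "h \<in> S"
      using facts(6) by (auto simp: subalgebra_def)
    moreover have "h \<in> R"
      using x hw DR subspace_diff[OF facts(3), of x w] by auto
    ultimately have "h = 0"
      using facts(5) by blast
    then show "x \<in> span ?D"
      using hw by simp
  qed
qed

lemma centralizer_radical_direct_sum: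
  assumes levi: "levi_decomposition S R"
  shows "is_direct_sum (centralizer R) (perp R) center"
  unfolding is_direct_sum_def
proof
  note facts = levi_decomposition_facts[OF levi]
  have "centralizer R = perp (R \<inter> bracket (replicate n UNIV))"
    unfolding radical_Int_derived_algebra[OF levi] perp_span by (rule centralizer_eq_perp)
  then show "centralizer R = {u + v | u v. u \<in> perp R \<and> v \<in> center}"
    by (simp add: perp_Int[OF facts(3) subspace_bracket] center_eq_perp)
  show "perp R \<inter> center = {0}"
  proof (intro equalityI subsetI)
    fix x
    assume x: "x \<in> perp R \<inter> center"
    \<comment> \<open>As part of the derived algebra, \<open>S\<close> is orthogonal to the center,
      while \<open>R\<close> is orthogonal to \<open>perp R\<close>; so \<open>x\<close> is
      orthogonal to everything.\<close>
    have "B y x = 0" for y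
    proof -
      obtain s r where y: "y = s + r" "s \<in> S" "r \<in> R"
        using levi_decomposition_cases[OF levi] .
      then have "s \<in> bracket (replicate n UNIV)"
        using strong_semisimple_perfect[OF facts(7)] by blast
      then show ?thesis
        using x y by (simp add: perp_def center_eq_perp B_add_left)
    qed
    then show "x \<in> {0}"
      using perp_UNIV by (auto simp: perp_def)
  qed (simp add: center_def subspace_perp subspace_centralizer subspace_0)
qed

text \<open>
  The ideals spanned by \<open>R\<close> and all but one of the simple ideals of \<open>S\<close> are maximal and intersect
  in \<open>R\<close>; nonsimplicity of the algebra makes them nonzero, so their complements are proper.
\<close>

lemma perp_radical_subset_Soc:
  assumes levi: "levi_decomposition S R" and nonsimple: "\<not> simple UNIV"
  shows "perp R \<subseteq> Soc"
proof -
  note facts = levi_decomposition_facts[OF levi]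
  define F where "F = simple_ideals S"
  \<comment> \<open>\<open>T U\<close> is the sum of the simple ideals other than \<open>U\<close>,
    and \<open>M U\<close> is the preimage of \<open>T U\<close> under the projection along
    \<open>R\<close> onto \<open>S\<close>.\<close>
  define T where "T U = span (\<Union>(F - {U}))" for U
  define M where "M U = {r + t | r t. r \<in> R \<and> t \<in> T U}" for U
  have F: "ideal_of S U" "simple U" "U \<inter> T U = {0}" "U \<subseteq> S" if "U \<in> F" for U
    using that facts(7)
    by (auto simp: F_def T_def simple_ideals_def strong_semisimple_def ideal_of_def)
  have spanF: "S = span (\<Union>F)"
    using facts(7) by (simp add: F_def strong_semisimple_def)
  have T: "ideal_of S (T U)" for U
    unfolding T_def using F facts(4) by (intro ideal_of_span_Union) auto
  then have TS: "T U \<subseteq> S" "subspace (T U)" for U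
    by (auto simp: ideal_of_def)
  have subM: "R \<subseteq> M U" "T U \<subseteq> M U" "subspace (M U)" for U
    using subspace_0[OF facts(3)] subspace_0[OF TS(2)] subspace_sums[OF facts(3) TS(2)]
    unfolding M_def by force+
  \<comment> \<open>The Levi components are unique because \<open>S \<inter> R = {0}\<close>, so
    membership in \<open>M U\<close> is decided by the component in \<open>S\<close>.\<close>
  have S_part: "s \<in> T U" if sr: "s \<in> S" "s + r \<in> M U" "r \<in> R" for s r U
  proof -
    obtain r' t where t: "s + r = r' + t" "r' \<in> R" "t \<in> T U"
      using sr(2) unfolding M_def by blast
    then have "s - t = r' - r"
      by (simp add: algebra_simps)
    moreover have "s - t \<in> S" "r' - r \<in> R"
      using sr t TS by (auto intro!: subspace_diff facts)
    ultimately have "s - t \<in> S \<inter> R"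
      by simp
    with facts(5) t show ?thesis
      by auto
  qed
  have M_ideal: "ideal_of UNIV (M U)" for U
    unfolding ideal_of_first_iff
  proof (intro conjI allI impI subM)
    fix x and xs :: "'a list"
    assume x: "x \<in> M U" and xs: "length xs = n - 1"
    \<comment> \<open>Modulo \<open>R\<close> the bracket can be computed on the components in
      \<open>S\<close>, where \<open>T U\<close> is an ideal.\<close>
    obtain f where f: "\<And>x. f x \<in> S" "\<And>x. x - f x \<in> R"
      using levi_decomposition_mod[OF levi] by metis
    have "f x \<in> T U"
      using S_part[of "f x" "x - f x"] f x by simp
    moreover have "set (map f xs) \<subseteq> S"
      using f by auto
    ultimately have "br (f x # map f xs) \<in> T U"
      using T[of U] xs unfolding ideal_of_first_iff by simp
    moreover have "br (x # xs) - br (f x # map f xs) \<in> R"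
      using xs n_ge_2 f br_mem_ideal[OF facts(1)]
      by (intro br_cong_mod[where J = R] facts) (auto simp: nth_Cons split: nat.split)
    moreover have "br (x # xs) = (br (x # xs) - br (f x # map f xs)) + br (f x # map f xs)"
      by simp
    ultimately show "br (x # xs) \<in> M U"
      unfolding M_def by blast
  qed simp
  \<comment> \<open>\<open>U\<close> and \<open>M U\<close> together span the algebra, since
    \<open>U\<close> and \<open>T U\<close> span \<open>S\<close>.\<close>
  have cover: "\<exists>u\<in>U. x - u \<in> M U" if "U \<in> F" for U x
  proof -
    obtain s r where x: "x = s + r" "s \<in> S" "r \<in> R"
      using levi_decomposition_cases[OF levi] .
    have "\<Union>F = U \<union> \<Union>(F - {U})"
      using that by blast
    moreover have "span U = U"
      using ideal_of_subspace[OF F(1)[OF that]] by (simp add: span_eq_iff)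
    ultimately have "S = {u + t | u t. u \<in> U \<and> t \<in> T U}"
      unfolding spanF T_def by (simp only: span_Un)
    then obtain u t where "s = u + t" "u \<in> U" "t \<in> T U"
      using x by blast
    moreover from this x have "x - u = r + t"
      by simp
    ultimately show ?thesis
      using x unfolding M_def by blast
  qed
  have "minimal_ideal (perp (M U))" if U: "U \<in> F" for U
  proof (rule perp_maximal_ideal_minimal[OF M_ideal])
    have "U \<noteq> {0}"
      using F(1,2)[OF U] bracket_simple by (auto simp: simple_def)
    then obtain u where u: "u \<in> U" "u \<noteq> 0"
      using subspace_0[OF ideal_of_subspace[OF F(1)[OF U]]] by blast
    then have "u \<notin> T U"
      using F(3)[OF U] by blast
    then have "u \<notin> M U"
      using S_part[of u 0 U] u F(4)[OF U] subspace_0[OF facts(3)] by auto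
    then show "M U \<noteq> UNIV"
      by blast
    show "M U \<noteq> {0}"
    proof
      assume "M U = {0}"
      then have "U = UNIV"
        using cover[OF U] by (metis UNIV_eq_I eq_iff_diff_eq_0 singletonD)
      then show False
        using F(2)[OF U] nonsimple by simp
    qed
    fix K
    assume K: "ideal_of UNIV K" "M U \<subseteq> K"
    \<comment> \<open>Maximality: by simplicity \<open>K\<close> meets \<open>U\<close> in zero or
      contains \<open>U\<close>. As \<open>U\<close> represents all classes modulo
      \<open>M U\<close>, the first case gives \<open>K = M U\<close> and the second
      \<open>K = UNIV\<close>.\<close>
    have "ideal_of U (K \<inter> U)"
      by (intro ideal_of_Int_subalgebra K subalgebra_ideal_of[OF F(1)[OF U]])
    then consider "K \<inter> U = {0}" | "K \<inter> U = U"
      using F(2)[OF U] by (auto simp: simple_def)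
    then show "K = M U \<or> K = UNIV"
    proof cases
      case 1
      have "x \<in> M U" if "x \<in> K" for x
      proof -
        obtain u where u: "u \<in> U" "x - u \<in> M U"
          using cover[OF U] by blast
        then have "x - (x - u) \<in> K"
          using that K ideal_of_subspace by (blast intro: subspace_diff)
        then have "u = 0"
          using 1 u by auto
        then show ?thesis
          using u by simp
      qed
      then show ?thesis
        using K by blast
    next
      case 2
      have "x \<in> K" for x
      proof -
        obtain u where u: "u \<in> U" "x - u \<in> M U"
          using cover[OF U] by blast
        then have "u + (x - u) \<in> K"
          using 2 K ideal_of_subspace by (blast intro: subspace_add)
        then show ?thesis
          by simp
      qed
      then show ?thesis
        by blast
    qed
  qed
  then have Soc_M: "perp Soc \<subseteq> M U" if "U \<in> F" for U
    using that minimal_ideal_subset_Soc perp_mono ideal_perp_perp[OF M_ideal] by metis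
  have "perp Soc \<subseteq> R"
  proof
    fix x
    assume x: "x \<in> perp Soc"
    obtain s r where sr: "x = s + r" "s \<in> S" "r \<in> R"
      using levi_decomposition_cases[OF levi] .
    \<comment> \<open>\<open>perp Soc\<close> lies in every \<open>M U\<close>, so \<open>s\<close>
      lies in every \<open>T U\<close>; independence of the simple ideals of \<open>S\<close> leaves
      only zero.\<close>
    have "s = 0"
    proof (rule independent_subspaces_Inter[of F])
      show "s \<in> span (\<Union>(F - {U}))" if "U \<in> F" for U
        using S_part[of s r U] Soc_M[OF that] x sr unfolding T_def by blast
      show "subspace U" "U \<inter> span (\<Union>(F - {U})) = {0}" if "U \<in> F" for U
        using F(1,3)[OF that] ideal_of_subspace by (auto simp: T_def)
      show "s \<in> span (\<Union>F)"
        using sr spanF by simp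
    qed
    then show "x \<in> R"
      using sr by simp
  qed
  then have "perp R \<subseteq> perp (perp Soc)"
    by (rule perp_mono)
  then show ?thesis
    by (simp add: perp_perp Soc_def)
qed

lemma Soc_eq_centralizer_radical:
  assumes levi: "levi_decomposition S R" and nonsimple: "\<not> simple UNIV"
    and dim: "dim UNIV \<noteq> 1"
  shows "Soc = centralizer R"
proof
  show "Soc \<subseteq> centralizer R"
    unfolding Soc_def
    using minimal_ideal_subset_centralizer levi_decomposition_facts(2)[OF levi]
    by (intro span_minimal subspace_centralizer) blast
  have "centralizer R = {u + v | u v. u \<in> perp R \<and> v \<in> center}"
    using centralizer_radical_direct_sum[OF levi] by (simp add: is_direct_sum_def)
  moreover have "perp R \<subseteq> Soc" "center \<subseteq> Soc" "subspace Soc"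
    using perp_radical_subset_Soc[OF levi nonsimple] center_subset_Soc[OF dim]
    by (auto simp: Soc_def)
  ultimately show "centralizer R \<subseteq> Soc"
    by (auto intro: subspace_add)
qed

end

theorem theorem4p7:
  fixes scale :: "complex \<Rightarrow> 'a::ab_group_add \<Rightarrow> 'a"
    and n :: nat
    and br :: "'a list \<Rightarrow> 'a"
    and B :: "'a \<Rightarrow> 'a \<Rightarrow> complex"
    and S R :: "'a set"
  assumes "metric_n_lie_algebra scale n br B"
    and "n_lie_algebra.levi_decomposition scale n br S R"
  shows "(\<not> n_lie_algebra.simple scale n br UNIV \<and> vector_space.dim scale (UNIV :: 'a set) \<noteq> 1 \<longrightarrow>
            n_lie_algebra.Soc scale n br = n_lie_algebra.centralizer scale n br R)
       \<and> is_direct_sum (n_lie_algebra.centralizer scale n br R)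
            (metric_n_lie_algebra.perp B R) (n_lie_algebra.center scale n br)"
proof -
  interpret metric_n_lie_algebra scale n br B
    by (fact assms(1))
  show ?thesis
    using Soc_eq_centralizer_radical[OF assms(2)] centralizer_radical_direct_sum[OF assms(2)]
    by blast
qed

end
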